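(* For any integer $t\geq 3$ with $t\equiv 1$ or $3 \pmod 6$, and any $n$, \[\operatorname{sat}_t(n,\mathfrak{R}(K_3))\leq \frac{3}{\log\binom{t}{2}}\,n\log n+3n.\] In particular, $\operatorname{sat}_3(n,\mathfrak{R}(K_3))\leq \frac{3}{\log 3}n\log n+3n$.
   Context: A $t$-edge-coloured graph is a graph $G$ with a function $c:E(G)\to\{1,\dots,t\}$ (not necessarily proper). A copy of $H$ is rainbow if all its edges receive distinct colours; $\mathfrak{R}(H)$ denotes the family of rainbow copies of $H$. A $t$-edge-coloured graph is $\mathfrak{R}(H)$-saturated if it contains no rainbow copy of $H$ but adding any non-edge in any colour from $\{1,\dots,t\}$ creates a rainbow copy of $H$. $\operatorname{sat}_t(n,\mathfrak{R}(H))$ is the minimum number of edges of such a graph on $n$ vertices. Logarithms are base 2. *)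

theory Defs
  imports Complex_Main "HOL-Number_Theory.Cong"
begin

type_synonym 'a ugraph = "'a set \<times> 'a set set"

abbreviation verts :: "'a ugraph \<Rightarrow> 'a set" where "verts \<equiv> fst"
abbreviation edges :: "'a ugraph \<Rightarrow> 'a set set" where "edges \<equiv> snd"

definition all_pairs :: "'a set \<Rightarrow> 'a set set" where
  "all_pairs V = {e. e \<subseteq> V \<and> card e = 2}"

definition fin_graph :: "'a ugraph \<Rightarrow> bool" where
  "fin_graph G \<longleftrightarrow> finite (verts G) \<and> edges G \<subseteq> all_pairs (verts G)"

definition complete_graph :: "nat \<Rightarrow> nat ugraph" where
  "complete_graph k = ({..<k}, all_pairs {..<k})"

definition subgraph :: "'a ugraph \<Rightarrow> 'a ugraph \<Rightarrow> bool" where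
  "subgraph K G \<longleftrightarrow> fin_graph K \<and> verts K \<subseteq> verts G \<and> edges K \<subseteq> edges G"

definition graph_iso :: "'b ugraph \<Rightarrow> 'a ugraph \<Rightarrow> bool" where
  "graph_iso H K \<longleftrightarrow>
     (\<exists>f. bij_betw f (verts H) (verts K) \<and> edges K = (\<lambda>e. f ` e) ` edges H)"

text \<open>An edge colouring is a total function on vertex sets; only its values on the edges
  of the graph it is paired with are relevant.\<close>

type_synonym 'a cgraph = "'a ugraph \<times> ('a set \<Rightarrow> nat)"

definition edge_coloured :: "nat \<Rightarrow> 'a cgraph \<Rightarrow> bool" where
  "edge_coloured t = (\<lambda>(G, c). fin_graph G \<and> (\<forall>e\<in>edges G. c e \<in> {1..t}))"

definition rainbow_copies :: "'b ugraph \<Rightarrow> 'a cgraph set" where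
  "rainbow_copies H = {(K, c). fin_graph K \<and> graph_iso H K \<and> inj_on c (edges K)}"

definition contains_member :: "'a cgraph set \<Rightarrow> 'a cgraph \<Rightarrow> bool" where
  "contains_member \<F> = (\<lambda>(G, c). \<exists>K. subgraph K G \<and> (K, c) \<in> \<F>)"

definition add_edge :: "'a set \<Rightarrow> nat \<Rightarrow> 'a cgraph \<Rightarrow> 'a cgraph" where
  "add_edge e i = (\<lambda>(G, c). ((verts G, insert e (edges G)), c(e := i)))"

definition saturated :: "nat \<Rightarrow> 'a cgraph set \<Rightarrow> 'a cgraph \<Rightarrow> bool" where
  "saturated t \<F> = (\<lambda>(G, c). edge_coloured t (G, c) \<and> \<not> contains_member \<F> (G, c) \<and>
     (\<forall>e \<in> all_pairs (verts G) - edges G. \<forall>i\<in>{1..t}.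
        contains_member \<F> (add_edge e i (G, c))))"

text \<open>Every finite graph has an isomorphic copy with vertices in \<^typ>\<open>nat\<close>, so minimising over
  graphs with natural-number vertices loses nothing. The infimum is an attained minimum
  whenever some saturated graph exists; see \<open>sat_attained\<close> for the rainbow families.\<close>

definition sat :: "nat \<Rightarrow> nat \<Rightarrow> nat cgraph set \<Rightarrow> nat" where
  "sat t n \<F> = Inf {card (edges G) | G c. card (verts G) = n \<and> saturated t \<F> (G, c)}"

lemma monochromatic_complete_saturated:
  assumes "t \<ge> 1" and "a \<in> edges H" "b \<in> edges H" "a \<noteq> b" and H: "fin_graph H"
  shows "saturated t (rainbow_copies H) (complete_graph n, \<lambda>_. 1)"
proof -
  have fin: "fin_graph (complete_graph n)"
    by (simp add: fin_graph_def complete_graph_def)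
  have "\<not> inj_on (\<lambda>_. 1 :: nat) (edges K)" if iso: "graph_iso H K" for K :: "nat ugraph"
  proof -
    obtain f where f: "bij_betw f (verts H) (verts K)" "edges K = (\<lambda>e. f ` e) ` edges H"
      using iso unfolding graph_iso_def by blast
    have "a \<subseteq> verts H" "b \<subseteq> verts H"
      using assms by (auto simp: fin_graph_def all_pairs_def)
    then have "f ` a \<noteq> f ` b"
      using f(1) \<open>a \<noteq> b\<close> by (metis bij_betw_def inj_on_image_eq_iff)
    moreover have "f ` a \<in> edges K" "f ` b \<in> edges K"
      using f(2) assms by auto
    ultimately show ?thesis by (metis inj_onD)
  qed
  then show ?thesis
    using fin \<open>t \<ge> 1\<close>
    by (auto simp: saturated_def edge_coloured_def contains_member_def rainbow_copies_def
        complete_graph_def)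
qed

lemma sat_attained:
  assumes "t \<ge> 1" and "a \<in> edges H" "b \<in> edges H" "a \<noteq> b" and "fin_graph H"
  shows "\<exists>(G :: nat ugraph) c. card (verts G) = n \<and> saturated t (rainbow_copies H) (G, c) \<and>
           card (edges G) = sat t n (rainbow_copies H)"
proof -
  let ?S = "{card (edges G) | (G :: nat ugraph) c. card (verts G) = n \<and> saturated t (rainbow_copies H) (G, c)}"
  have "card (verts (complete_graph n)) = n"
    by (simp add: complete_graph_def)
  then have "?S \<noteq> {}"
    using monochromatic_complete_saturated[OF assms] by blast
  then have "Inf ?S \<in> ?S" by (rule Inf_nat_def1)
  then show ?thesis unfolding sat_def by force
qed

end

theory Submission imports Defs
begin

text \<open>Join three hub vertices to all other vertices, and split the others into
  \<open>N = t choose 2\<close> classes of nearly equal size. The colours from a vertex to the three hubs form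
  a word depending only on its class, so no rainbow triangle meets a hub. The words are the
  cyclic rotations of the blocks of a Steiner triple system on the colours: for two of
  them and any colour \<open>i\<close>, some position carries two different colours other than \<open>i\<close>, so
  non-edges between classes are saturated. Recursing inside the classes costs at most
  \<open>3 * n\<close> edges per level, and \<open>d\<close> levels suffice when \<open>n \<le> N ^ d\<close>.\<close>

section \<open>Steiner triple systems as quasigroups\<close>

text \<open>Algebraic form of a Steiner triple system: for distinct points, \<open>f a b\<close> is
  the third point of their block. Idempotence is the convention for \<open>a = b\<close>, so blocks
  never have to appear as sets.\<close>

definition steiner_quasigroup :: "'a set \<Rightarrow> ('a \<Rightarrow> 'a \<Rightarrow> 'a) \<Rightarrow> bool" where
  "steiner_quasigroup S f \<longleftrightarrow>
     (\<forall>a\<in>S. \<forall>b\<in>S. f a b \<in> S \<and> f a b = f b a \<and> f a (f a b) = b \<and> f a a = a)"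

lemma steiner_quasigroup_transport:
  assumes S: "steiner_quasigroup S f" and g: "bij_betw g S T"
  shows "\<exists>f'. steiner_quasigroup T f'"
proof -
  let ?h = "inv_into S g"
  have h: "?h a \<in> S" "g (?h a) = a" if "a \<in> T" for a
    using that g by (auto simp: bij_betw_def inv_into_into f_inv_into_f)
  have g': "g a \<in> T" "?h (g a) = a" if "a \<in> S" for a
    using that g by (auto simp: bij_betw_def)
  have "steiner_quasigroup T (\<lambda>a b. g (f (?h a) (?h b)))"
    unfolding steiner_quasigroup_def
  proof (intro ballI)
    fix a b assume ab: "a \<in> T" "b \<in> T"
    let ?f = "f (?h a) (?h b)"
    have "?f \<in> S" "?f = f (?h b) (?h a)" "f (?h a) ?f = ?h b" "f (?h a) (?h a) = ?h a"
      using S h ab unfolding steiner_quasigroup_def by auto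
    then show "g ?f \<in> T \<and> g ?f = g (f (?h b) (?h a)) \<and> g (f (?h a) (?h (g ?f))) = b \<and>
        g (f (?h a) (?h a)) = a"
      by (simp add: h g' ab)
  qed
  then show ?thesis by blast
qed

section \<open>The Bose and Skolem constructions on three cyclic levels\<close>

datatype three = Zero | One | Two

fun nxt :: "three \<Rightarrow> three" where
  "nxt Zero = One" | "nxt One = Two" | "nxt Two = Zero"

lemma UNIV_three: "UNIV = {Zero, One, Two}"
  by (auto intro: three.exhaust)

lemma nxt_cases: "(j = i) \<or> (j = nxt i) \<or> (j = nxt (nxt i))"
  by (cases i; cases j) auto

lemma nxt_simps [simp]:
  "nxt (nxt (nxt i)) = i" "nxt i \<noteq> i" "i \<noteq> nxt i" "nxt (nxt i) \<noteq> i" "i \<noteq> nxt (nxt i)"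
  "nxt i = nxt j \<longleftrightarrow> i = j"
  by (cases i; cases j; simp)+

text \<open>The Bose and Skolem constructions in one: \<open>op\<close> is a commutative quasigroup with left
  division \<open>dv\<close>, idempotent on \<open>H\<close>, while squaring maps the rest of \<open>Q\<close> bijectively to \<open>H\<close>
  with inverse \<open>r\<close>. The point \<open>None\<close> is the point at infinity; Bose is \<open>H = Q\<close>, without it.\<close>

locale half_idempotent =
  fixes Q H :: "'a set" and op dv :: "'a \<Rightarrow> 'a \<Rightarrow> 'a" and r :: "'a \<Rightarrow> 'a"
  assumes H: "H \<subseteq> Q"
    and op_closed: "x \<in> Q \<Longrightarrow> y \<in> Q \<Longrightarrow> op x y \<in> Q"
    and dv_closed: "x \<in> Q \<Longrightarrow> y \<in> Q \<Longrightarrow> dv x y \<in> Q"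
    and comm: "x \<in> Q \<Longrightarrow> y \<in> Q \<Longrightarrow> op x y = op y x"
    and op_dv: "x \<in> Q \<Longrightarrow> y \<in> Q \<Longrightarrow> op x (dv x y) = y"
    and dv_op: "x \<in> Q \<Longrightarrow> y \<in> Q \<Longrightarrow> dv x (op x y) = y"
    and idem: "x \<in> H \<Longrightarrow> op x x = x"
    and sq_H: "x \<in> Q - H \<Longrightarrow> op x x \<in> H"
    and r_sq: "x \<in> Q - H \<Longrightarrow> r (op x x) = x"
    and r_closed: "H \<noteq> Q \<Longrightarrow> x \<in> H \<Longrightarrow> r x \<in> Q - H"
    and sq_r: "H \<noteq> Q \<Longrightarrow> x \<in> H \<Longrightarrow> op (r x) (r x) = x"
begin

text \<open>The third point for \<open>x\<close> on level \<open>i\<close> and \<open>y\<close> on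
  the next level. The generic block has \<open>x\<close> and \<open>z\<close> on level
  \<open>i\<close> with \<open>op x z = y\<close>. It degenerates for \<open>z = x\<close>, when
  \<open>y\<close> is the square of \<open>x\<close>: if \<open>x\<close> is in \<open>H\<close>,
  then \<open>y = x\<close> and the block is the column over \<open>x\<close>; otherwise the block
  passes through infinity.\<close>

definition across :: "'a \<Rightarrow> 'a \<Rightarrow> three \<Rightarrow> ('a \<times> three) option" where
  "across x y i =
     (if dv x y \<noteq> x then Some (dv x y, i) else if x \<in> H then Some (x, nxt (nxt i)) else None)"

text \<open>A block through infinity joins some \<open>x\<close> outside \<open>H\<close> to its
  square one level up. An element of \<open>H\<close> is the square in such a block, so its partner
  is its root \<open>r x\<close> one level down.\<close>

definition at_inf :: "'a \<Rightarrow> three \<Rightarrow> ('a \<times> three) option" where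
  "at_inf x i = (if x \<in> H then Some (r x, nxt (nxt i)) else Some (op x x, nxt i))"

fun third :: "('a \<times> three) option \<Rightarrow> ('a \<times> three) option \<Rightarrow> ('a \<times> three) option" where
  "third None None = None"
| "third None (Some (x, i)) = at_inf x i"
| "third (Some (x, i)) None = at_inf x i"
| "third (Some (x, i)) (Some (y, j)) =
     (if i = j then (if x = y then Some (x, i) else Some (op x y, nxt i))
      else if j = nxt i then across x y i else across y x j)"

definition points :: "('a \<times> three) option set" where
  "points = Some ` (Q \<times> UNIV) \<union> (if H = Q then {} else {None})"

lemma in_points [simp]:
  "Some (x, i) \<in> points \<longleftrightarrow> x \<in> Q" "None \<in> points \<longleftrightarrow> H \<noteq> Q"
  by (auto simp: points_def)

lemma dv_eq_self_iff: "x \<in> Q \<Longrightarrow> y \<in> Q \<Longrightarrow> dv x y = x \<longleftrightarrow> op x x = y"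
  using op_dv dv_op by metis

text \<open>The content is \<open>third a (third a b) = b\<close>. It is checked by whether infinity
  is involved and, if not, by whether the second point lies on the same level as the first, the next
  or the previous one.\<close>

lemma steiner: "steiner_quasigroup points third"
proof -
  have idem_third: "third a a = a" for a by (cases a) auto
  have sym: "third a b = third b a" if "a \<in> points" "b \<in> points" for a b
  proof (cases a; cases b)
    fix p q assume "a = Some p" "b = Some q"
    moreover obtain x i y j where "p = (x, i)" "q = (y, j)" by fastforce
    ultimately show ?thesis using that nxt_cases[of i j] by (auto simp: comm)
  qed auto
  have closed: "third a b \<in> points" if "a \<in> points" "b \<in> points" for a b
  proof (cases a; cases b)
    fix p q assume "a = Some p" "b = Some q"
    moreover obtain x i y j where "p = (x, i)" "q = (y, j)" by fastforce
    ultimately show ?thesis using that H by (auto simp: across_def op_closed dv_closed)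
  next
    fix p assume "a = None" "b = Some p"
    moreover obtain x i where "p = (x, i)" by fastforce
    ultimately show ?thesis using that r_closed by (auto simp: at_inf_def op_closed)
  next
    fix p assume "b = None" "a = Some p"
    moreover obtain x i where "p = (x, i)" by fastforce
    ultimately show ?thesis using that r_closed by (auto simp: at_inf_def op_closed)
  qed (use that in auto)
  have inv: "third a (third a b) = b" if ab: "a \<in> points" "b \<in> points" for a b
  proof (cases a)
    case None
    show ?thesis
    proof (cases b)
      case (Some q)
      obtain y j where q: "q = (y, j)" by fastforce
      show ?thesis using ab None Some q r_closed[of y] sq_r[of y] sq_H[of y] r_sq[of y]
        by (auto simp: at_inf_def)
    qed (simp add: None)
  next
    case (Some p)
    obtain x i where p: "p = (x, i)" by fastforce
    have x: "x \<in> Q" using ab Some p by simp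
    show ?thesis
    proof (cases b)
      case None
      then have HQ: "H \<noteq> Q" using ab by simp
      show ?thesis
      proof (cases "x \<in> H")
        case True
        \<comment> \<open>Since \<open>x\<close> is the square of its root, the root and
          \<open>x\<close> form the degenerate pair whose block leads back to infinity.\<close>
        then have "dv (r x) x = r x" using dv_eq_self_iff r_closed[OF HQ True] sq_r[OF HQ True] x by auto
        then show ?thesis using Some p None True x HQ r_closed[OF HQ True]
          by (auto simp: at_inf_def across_def)
      next
        case False
        have "dv x (op x x) = x" using dv_op x by simp
        then show ?thesis using Some p None False x HQ by (auto simp: at_inf_def across_def)
      qed
    next
      case b: (Some q)
      obtain y j where q: "q = (y, j)" by fastforce
      have y: "y \<in> Q" using ab b q by simp
      consider "j = i" | "j = nxt i" | "j = nxt (nxt i)" using nxt_cases by blast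
      then show ?thesis
      proof cases
        case 1
        then show ?thesis using Some p b q x y by (auto simp: across_def dv_op)
      next
        case 2
        have "op x (dv x y) = y" using op_dv x y by simp
        moreover have "x \<in> H \<Longrightarrow> dv x y = x \<Longrightarrow> y = x"
          using idem dv_eq_self_iff x y by auto
        moreover have "x \<in> H \<Longrightarrow> dv x x = x" using idem dv_eq_self_iff x by auto
        moreover have "dv x y = x \<Longrightarrow> op x x = y" using dv_eq_self_iff x y by auto
        ultimately show ?thesis using Some p b q x y 2 by (auto simp: across_def at_inf_def)
      next
        case 3
        have sq: "dv y x = y \<longleftrightarrow> op y y = x" using dv_eq_self_iff x y by simp
        have "op y (dv y x) = x" using op_dv x y by simp
        \<comment> \<open>Commutativity exchanges the two points on the lower level: with
          \<open>z = dv y x\<close>, the equation \<open>op y z = x\<close> becomes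
          \<open>op z y = x\<close>, and dividing by \<open>z\<close> returns
          \<open>y\<close>.\<close>
        then have 4: "op (dv y x) y = x" using comm dv_closed x y by metis
        then have "dv (dv y x) x = y" using dv_op dv_closed x y by metis
        moreover have "y \<in> H \<Longrightarrow> dv y x = y \<Longrightarrow> x = y" using idem sq by auto
        moreover have "x \<in> H \<Longrightarrow> dv x x = x" using idem dv_eq_self_iff x by auto
        moreover have "y \<notin> H \<Longrightarrow> op y y = x \<Longrightarrow> x \<in> H \<and> r x = y" using sq_H r_sq y by auto
        ultimately show ?thesis using Some p b q x y 3 sq by (auto simp: across_def at_inf_def)
      qed
    qed
  qed
  show ?thesis unfolding steiner_quasigroup_def using idem_third sym closed inv by blast
qed

lemma finite_points: "finite Q \<Longrightarrow> finite points"
  by (simp add: points_def UNIV_three)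

lemma card_points: "finite Q \<Longrightarrow> card points = 3 * card Q + (if H = Q then 0 else 1)"
  by (auto simp: points_def card_insert_if card_image card_cartesian_product UNIV_three finite_cartesian_product)

end

text \<open>Lists the even residues before the odd ones: division by 2 modulo \<open>m\<close> if \<open>m\<close> is odd (Bose),
  Skolem's renumbering if \<open>m\<close> is even.\<close>

definition halve :: "nat \<Rightarrow> nat \<Rightarrow> nat" where
  "halve m v = (if even v then v else v + m) div 2"

lemma halve_less: "v < m \<Longrightarrow> halve m v < m"
  unfolding halve_def by auto

text \<open>Even values land below \<open>m / 2\<close> and odd ones at or above it, so the two
  parities never collide.\<close>

lemma halve_even_less_odd:
  assumes "v < m" "even v" "odd w"
  shows "halve m v < halve m w"
proof -
  obtain a b where "v = 2 * a" "w = 2 * b + 1" using assms by (metis evenE oddE)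
  then have "halve m v = a" "halve m w = (2 * b + 1 + m) div 2" by (auto simp: halve_def)
  with \<open>v < m\<close> \<open>v = 2 * a\<close> show ?thesis by linarith
qed

lemma halve_inj:
  assumes "v < m" "w < m" "halve m v = halve m w"
  shows "v = w"
proof (cases "even v")
  case True
  then have "even w" using assms halve_even_less_odd by (metis less_irrefl)
  then show ?thesis using True assms(3) by (auto simp: halve_def elim!: evenE)
next
  case False
  then have "odd w" using assms halve_even_less_odd by (metis less_irrefl)
  with False obtain a b where "v = 2 * a + 1" "w = 2 * b + 1" by (metis oddE)
  moreover from this have "(2 * a + 1 + m) div 2 = (2 * b + 1 + m) div 2"
    using assms(3) by (simp add: halve_def)
  then have "a = b" by linarith
  ultimately show ?thesis by simp
qed

text \<open>Odd \<open>m\<close> gives Bose's system with \<open>H = Q\<close>; even positive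
  \<open>m\<close> gives Skolem's, with the lower half of the residues as \<open>H\<close>. For
  \<open>m = 0\<close> both sets are empty and coincide, so infinity is not added; hence the extra
  case in the number of points.\<close>

lemma ex_steiner_mod:
  fixes m :: nat
  shows "\<exists>f. steiner_quasigroup {1..3 * m + (if odd m \<or> m = 0 then 0 else 1)} f"
proof -
  define op where "op x y = halve m ((x + y) mod m)" for x y
  define Q where "Q = {..<m}"
  define H where "H = {x. x < m \<and> (odd m \<or> 2 * x < m)}"
  define dv where "dv x = inv_into Q (op x)" for x
  have closed: "op x y \<in> Q" if "x \<in> Q" for x y
    using that unfolding op_def Q_def by (auto intro!: halve_less)
  have inj: "inj_on (op x) Q" if "x \<in> Q" for x
  proof (rule inj_onI)
    fix y z assume yz: "y \<in> Q" "z \<in> Q" "op x y = op x z"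
    have m: "0 < m" using yz by (auto simp: Q_def)
    have "(x + y) mod m = (x + z) mod m"
      by (rule halve_inj[of _ m]) (use yz m in \<open>simp_all add: op_def\<close>)
    then have "[x + y = x + z] (mod m)" by (simp add: cong_def)
    then have "[y = z] (mod m)" by (simp add: cong_add_lcancel_nat)
    then show "y = z" using yz by (auto simp: cong_def Q_def)
  qed
  have surj: "op x ` Q = Q" if "x \<in> Q" for x
    using inj[OF that] closed[OF that] by (intro endo_inj_surj) (auto simp: Q_def)
  have dbl: "(x + x) mod m = (if 2 * x < m then 2 * x else 2 * x - m)" if "x < m" for x
    using that by (auto simp: mod_if)
  \<comment> \<open>Doubling and halving cancel, except on the upper half for even \<open>m\<close>,
    where reduction modulo \<open>m\<close> loses \<open>m div 2\<close>. So squaring shifts the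
    upper half onto the lower one, and adding \<open>m div 2\<close> is the inverse
    \<open>r\<close>.\<close>
  have sq: "op x x = (if odd m \<or> 2 * x < m then x else x - m div 2)" if "x < m" for x
    unfolding op_def dbl[OF that] halve_def using that by (auto; presburger)
  interpret half_idempotent Q H op dv "\<lambda>x. x + m div 2"
  proof
    show "H \<subseteq> Q" by (auto simp: H_def Q_def)
    show "op x y \<in> Q" if "x \<in> Q" "y \<in> Q" for x y using closed that by simp
    show "dv x y \<in> Q" if "x \<in> Q" "y \<in> Q" for x y
      unfolding dv_def using surj that by (intro inv_into_into) auto
    show "op x y = op y x" for x y by (simp add: op_def add.commute)
    show "op x (dv x y) = y" if "x \<in> Q" "y \<in> Q" for x y
      unfolding dv_def using surj that by (intro f_inv_into_f) auto
    show "dv x (op x y) = y" if "x \<in> Q" "y \<in> Q" for x y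
      unfolding dv_def using inj that by (intro inv_into_f_f) auto
    show "op x x = x" if "x \<in> H" for x using that sq by (auto simp: H_def)
    show "op x x \<in> H" if "x \<in> Q - H" for x using that sq by (auto simp: H_def Q_def)
    show "op x x + m div 2 = x" if "x \<in> Q - H" for x using that sq by (auto simp: H_def Q_def)
    fix x assume *: "H \<noteq> Q" "x \<in> H"
    then have ev: "even m" by (auto simp: H_def Q_def)
    with * show r: "x + m div 2 \<in> Q - H" by (auto simp: H_def Q_def)
    then show "op (x + m div 2) (x + m div 2) = x" using ev sq[of "x + m div 2"]
      by (auto simp: H_def Q_def)
  qed
  have "H = Q \<longleftrightarrow> odd m \<or> m = 0"
  proof
    assume "H = Q"
    \<comment> \<open>For even positive \<open>m\<close> the largest residue lies in the upper half,
      outside \<open>H\<close>.\<close>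
    then have "m > 0 \<Longrightarrow> m - 1 \<in> H" by (auto simp: Q_def)
    then show "odd m \<or> m = 0" by (auto simp: H_def; presburger)
  qed (auto simp: H_def Q_def)
  then have "card points = 3 * m + (if odd m \<or> m = 0 then 0 else 1)"
    using card_points by (simp add: Q_def)
  moreover have "finite points" by (rule finite_points) (simp add: Q_def)
  ultimately obtain g where "bij_betw g points {1..3 * m + (if odd m \<or> m = 0 then 0 else 1)}"
    using finite_same_card_bij[of points "{1..3 * m + (if odd m \<or> m = 0 then 0 else 1)}"] by auto
  then show ?thesis using steiner_quasigroup_transport steiner by blast
qed

text \<open>Residue 1 is covered by Skolem's case \<open>m = 2 * k\<close>, residue 3 by Bose's case
  \<open>m = 2 * k + 1\<close>. The bound \<open>t \<ge> 3\<close> excludes \<open>k = 0\<close> in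
  the former.\<close>

lemma ex_steiner_quasigroup:
  assumes "t \<ge> 3" "[t = 1] (mod 6) \<or> [t = 3] (mod 6)"
  shows "\<exists>f :: nat \<Rightarrow> nat \<Rightarrow> nat. steiner_quasigroup {1..t} f"
proof -
  have "t mod 6 = 1 \<or> t mod 6 = 3" using assms(2) by (simp add: cong_def)
  then have "\<exists>k. t = 6 * k + 1 \<or> t = 6 * k + 3" by presburger
  then obtain k where "t = 6 * k + 1 \<or> t = 6 * k + 3" ..
  then consider "t = 3 * (2 * k) + 1" "k \<noteq> 0" | "t = 3 * (2 * k + 1)"
    using assms(1) by (cases "k = 0") auto
  then show ?thesis
  proof cases
    case 1
    then show ?thesis using ex_steiner_mod[of "2 * k"] by simp
  next
    case 2
    then show ?thesis using ex_steiner_mod[of "2 * k + 1"] by simp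
  qed
qed

section \<open>Separated words from cyclically oriented triples\<close>

text \<open>Here \<open>i\<close> stands for the colour of an added edge and \<open>p\<close> for a
  common neighbour of its ends that completes a rainbow triangle.\<close>

definition separated :: "nat \<Rightarrow> (nat \<Rightarrow> nat) \<Rightarrow> (nat \<Rightarrow> nat) \<Rightarrow> bool" where
  "separated k x y \<longleftrightarrow> (\<forall>i. \<exists>p<k. x p \<noteq> y p \<and> x p \<noteq> i \<and> y p \<noteq> i)"

text \<open>The last clause reads the columns of words 0, 1 and 2 as words of length three. It
  handles the non-edges between hubs, and one vertex in each of the classes 0, 1, 2 is enough to
  realise it.\<close>

definition rainbow_code :: "nat \<Rightarrow> nat \<Rightarrow> (nat \<Rightarrow> nat \<Rightarrow> nat) \<Rightarrow> bool" where
  "rainbow_code t N v \<longleftrightarrow>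
     (\<forall>j<N. \<forall>p<3. v j p \<in> {1..t}) \<and>
     (\<forall>j<N. \<forall>k<N. j \<noteq> k \<longrightarrow> separated 3 (v j) (v k)) \<and>
     (\<forall>p<3. \<forall>q<3. p \<noteq> q \<longrightarrow> separated 3 (\<lambda>j. v j p) (\<lambda>j. v j q))"

lemma ex_less_3: "(\<exists>p<3. P p) \<longleftrightarrow> P 0 \<or> P 1 \<or> P (2::nat)"
  by (auto simp: numeral_3_eq_3 less_Suc_eq numeral_2_eq_2)

lemma all_less_3: "(\<forall>p<3. P p) \<longleftrightarrow> P 0 \<and> P 1 \<and> P (2::nat)"
  using ex_less_3[of "\<lambda>p. \<not> P p"] by blast

text \<open>The strict cyclic order: invariant under rotation, and destroyed by exchanging two
  entries.\<close>

definition cyc :: "nat \<Rightarrow> nat \<Rightarrow> nat \<Rightarrow> bool" where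
  "cyc a b c \<longleftrightarrow> a < b \<and> b < c \<or> b < c \<and> c < a \<or> c < a \<and> a < b"

definition oriented_block :: "(nat \<Rightarrow> nat \<Rightarrow> nat) \<Rightarrow> nat set \<Rightarrow> (nat \<Rightarrow> nat) \<Rightarrow> bool" where
  "oriented_block f S x \<longleftrightarrow> cyc (x 0) (x 1) (x 2) \<and> x 0 \<in> S \<and> x 1 \<in> S \<and> x 2 \<in> S \<and>
     f (x 0) (x 1) = x 2 \<and> f (x 0) (x 2) = x 1 \<and> f (x 1) (x 2) = x 0"

text \<open>If some colour blocks all three positions, then the two blocks share two points,
  so they coincide, and the common cyclic orientation excludes a transposition.\<close>

lemma oriented_block_separated:
  assumes f: "steiner_quasigroup S f" and x: "oriented_block f S x" and y: "oriented_block f S y"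
    and ne: "\<exists>p<3. x p \<noteq> y p"
  shows "separated 3 x y"
proof -
  have fc: "f a b = f b a" if "a \<in> S" "b \<in> S" for a b
    using f that by (auto simp: steiner_quasigroup_def)
  show ?thesis unfolding separated_def ex_less_3
  proof (rule allI, rule ccontr)
    fix i
    \<comment> \<open>As \<open>i\<close> occurs at most once in each word, it blocks at most two
      positions, so the words agree somewhere. If they agree exactly once, \<open>i\<close> occurs
      in both words at different positions and is a second common point; then \<open>y\<close> is
      \<open>x\<close> with two entries exchanged.\<close>
    assume "\<not> (x 0 \<noteq> y 0 \<and> x 0 \<noteq> i \<and> y 0 \<noteq> i \<or> x 1 \<noteq> y 1 \<and> x 1 \<noteq> i \<and> y 1 \<noteq> i \<or>
               x 2 \<noteq> y 2 \<and> x 2 \<noteq> i \<and> y 2 \<noteq> i)"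
    moreover have "x 0 \<noteq> x 1" "x 1 \<noteq> x 2" "x 0 \<noteq> x 2" "y 0 \<noteq> y 1" "y 1 \<noteq> y 2" "y 0 \<noteq> y 2"
      using x y by (auto simp: oriented_block_def cyc_def)
    moreover have "x 0 \<noteq> y 0 \<or> x 1 \<noteq> y 1 \<or> x 2 \<noteq> y 2"
      using ne by (auto simp: ex_less_3)
    moreover have "\<not> (x 0 = y 0 \<and> x 1 = y 2 \<and> x 2 = y 1)" "\<not> (x 1 = y 1 \<and> x 0 = y 2 \<and> x 2 = y 0)"
      "\<not> (x 2 = y 2 \<and> x 0 = y 1 \<and> x 1 = y 0)"
      using x y by (auto simp: oriented_block_def cyc_def)
    moreover note x[unfolded oriented_block_def] y[unfolded oriented_block_def]
      fc[of "y 0" "y 1"] fc[of "y 0" "y 2"] fc[of "y 1" "y 2"]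
    ultimately show False by metis
  qed
qed

text \<open>The rotation that starts with the third point, so the three pairs inside a block index
  its three rotations and no block has to be chosen.\<close>

definition block_word :: "(nat \<Rightarrow> nat \<Rightarrow> nat) \<Rightarrow> nat \<times> nat \<Rightarrow> nat \<Rightarrow> nat" where
  "block_word f = (\<lambda>(a, b) p. let c = f a b in
     if p = 0 then c else if p = 1 \<longleftrightarrow> (a < c \<and> c < b) then b else a)"

text \<open>With \<open>c = f a b\<close>, the cyclic order starting at \<open>c\<close> is
  \<open>c, b, a\<close> if \<open>c\<close> lies between \<open>a\<close> and \<open>b\<close>, and
  \<open>c, a, b\<close> otherwise.\<close>

lemma block_word_oriented:
  assumes f: "steiner_quasigroup S f" and ab: "a \<in> S" "b \<in> S" "a < b"
  shows "oriented_block f S (block_word f (a, b))"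
proof -
  note F = f[unfolded steiner_quasigroup_def, rule_format]
  have S: "f a b \<in> S" "f b a = f a b" "f a (f a b) = b" "f a a = a" "f b b = b"
    using F ab by auto
  have "f b (f a b) = a" using F[of b a] F[of a b] ab by simp
  moreover have "f (f a b) a = b" "f (f a b) b = f b (f a b)"
    using F[of "f a b" a] F[of "f a b" b] S ab by auto
  ultimately have S: "f a b \<in> S" "f b a = f a b" "f a (f a b) = b" "f b (f a b) = a"
      "f (f a b) a = b" "f (f a b) b = a" "f a a = a" "f b b = b"
    using S by auto
  \<comment> \<open>If \<open>f a b\<close> were \<open>a\<close>, then
    \<open>b = f a (f a b) = f a a = a\<close>; likewise for \<open>b\<close>.\<close>
  then have "f a b \<noteq> a" "f a b \<noteq> b" using ab by auto
  then show ?thesis using ab S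
    by (auto simp: oriented_block_def block_word_def cyc_def Let_def)
qed

text \<open>Positions 1 and 2 carry \<open>a\<close> and \<open>b\<close> in some order, and the
  smaller one is \<open>a\<close>.\<close>

lemma block_word_inj:
  assumes "a < b" "a' < b'" "\<forall>p<3. block_word f (a, b) p = block_word f (a', b') p"
  shows "(a, b) = (a', b')"
  using assms unfolding all_less_3 by (auto simp: block_word_def Let_def split: if_splits)

lemma card_ordered_pairs: "card {(a, b). a \<in> {1..t} \<and> b \<in> {1..t} \<and> a < (b::nat)} = t choose 2"
proof -
  have "bij_betw (\<lambda>(a, b). {a, b}) {(a, b). a \<in> {1..t} \<and> b \<in> {1..t} \<and> a < b}
          {e. e \<subseteq> {1..t} \<and> card e = 2}"
    unfolding bij_betw_def
  proof
    show "inj_on (\<lambda>(a, b). {a, b}) {(a, b). a \<in> {1..t} \<and> b \<in> {1..t} \<and> a < b}"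
      by (auto simp: inj_on_def doubleton_eq_iff)
    show "(\<lambda>(a, b). {a, b}) ` {(a, b). a \<in> {1..t} \<and> b \<in> {1..t} \<and> a < b} =
        {e. e \<subseteq> {1..t} \<and> card e = 2}"
    proof (intro equalityI subsetI)
      fix e assume e: "e \<in> {e. e \<subseteq> {1..t} \<and> card e = 2}"
      then obtain a b where "e = {a, b}" "a \<noteq> b" by (auto simp: card_2_iff)
      then have "e = {min a b, max a b}" "min a b < max a b" by (auto simp: min_def max_def)
      with e show "e \<in> (\<lambda>(a, b). {a, b}) ` {(a, b). a \<in> {1..t} \<and> b \<in> {1..t} \<and> a < b}"
        by (intro image_eqI[of _ _ "(min a b, max a b)"]) auto
    qed auto
  qed
  then show ?thesis by (simp add: bij_betw_same_card n_subsets)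
qed

text \<open>The first three codewords are the rotations of one block, which separates the columns.\<close>

lemma ex_code:
  assumes f: "steiner_quasigroup {1..t} f" and t: "t \<ge> 3"
  shows "\<exists>v. rainbow_code t (t choose 2) v"
proof -
  let ?S = "{1..t}"
  define P where "P = {(a, b). a \<in> ?S \<and> b \<in> ?S \<and> a < b}"
  let ?w = "block_word f"
  have w: "oriented_block f ?S (?w p)" if "p \<in> P" for p
    using that block_word_oriented[OF f] by (auto simp: P_def)
  define c where "c = f 1 2"
  have S12: "1 \<in> ?S" "2 \<in> ?S" using t by auto
  note F = f[unfolded steiner_quasigroup_def, rule_format]
  have "c \<in> ?S" "f 1 c = 2" "f 2 1 = c" "f 1 1 = 1" "f 2 2 = 2"
    unfolding c_def using F S12 by blast+
  moreover have "f 2 (f 2 1) = 1"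
    using F[OF S12(2,1)] by blast
  ultimately have c: "c \<in> ?S" "f 1 c = 2" "f 2 c = 1" "f 1 1 = 1" "f 2 2 = 2"
    by simp_all
  then have "c \<noteq> 1" "c \<noteq> 2" by auto
  then have f12: "f (Suc 0) 2 = c" and c3: "c > 2" using c(1) by (auto simp: c_def)
  \<comment> \<open>The three pairs inside the block of 1, 2 and \<open>c\<close>. As
    \<open>c > 2\<close>, their words are \<open>c, 1, 2\<close> and \<open>2, c, 1\<close> and
    \<open>1, 2, c\<close>. They head the list \<open>xs\<close>, so they become words 0, 1 and
    2.\<close>
  let ?B = "{(1, 2), (1, c), (2, c)}"
  have B: "?B \<subseteq> P" using t c(1) c3 by (auto simp: P_def)
  have fin: "finite P" by (rule finite_subset[of _ "?S \<times> ?S"]) (auto simp: P_def)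
  then obtain ys where ys: "set ys = P - ?B" "distinct ys"
    using finite_distinct_list[of "P - ?B"] by auto
  define xs where "xs = (1, 2) # (1, c) # (2, c) # ys"
  have "set xs = ?B \<union> (P - ?B)"
    by (simp only: xs_def list.set(2) ys(1) Un_insert_left Un_empty_left)
  then have "set xs = P" using B by (simp only: Un_Diff_cancel Un_absorb1)
  moreover have "distinct xs" using ys c3 by (simp add: xs_def)
  ultimately have xs: "set xs = P" "distinct xs" .
  have "card P = t choose 2" unfolding P_def by (rule card_ordered_pairs)
  with distinct_card[OF xs(2)] have len: "length xs = t choose 2" by (simp only: xs(1))
  have "rainbow_code t (t choose 2) (\<lambda>j. ?w (xs ! j))"
    unfolding rainbow_code_def
  proof (intro conjI allI impI)
    fix j p :: nat assume "j < t choose 2" "p < 3"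
    then have "xs ! j \<in> P" using xs(1) len nth_mem by metis
    then have "oriented_block f ?S (?w (xs ! j))" by (rule w)
    then have "\<forall>p<3. ?w (xs ! j) p \<in> ?S" unfolding all_less_3 oriented_block_def by blast
    then show "?w (xs ! j) p \<in> ?S" using \<open>p < 3\<close> by blast
  next
    fix j k assume jk: "j < t choose 2" "k < t choose 2" "j \<noteq> k"
    then have P: "xs ! j \<in> P" "xs ! k \<in> P" using xs(1) len nth_mem by metis+
    have ne: "xs ! j \<noteq> xs ! k" using jk xs(2) len nth_eq_iff_index_eq by metis
    obtain a b a' b' where ab: "xs ! j = (a, b)" "xs ! k = (a', b')" by fastforce
    then have "a < b" "a' < b'" using P by (auto simp: P_def)
    then have "\<exists>p<3. ?w (xs ! j) p \<noteq> ?w (xs ! k) p"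
      using block_word_inj[of a b a' b' f] ne ab by auto
    then show "separated 3 (?w (xs ! j)) (?w (xs ! k))"
      using oriented_block_separated[OF f w[OF P(1)] w[OF P(2)]] by blast
  next
    fix p q :: nat
    assume "p < 3" "q < 3" "p \<noteq> q"
    \<comment> \<open>The first three words form a Latin square: two columns differ in every row,
      and \<open>i\<close> occurs at most once in each, so some row avoids it.\<close>
    moreover have "\<forall>p<3. \<forall>q<3. p \<noteq> q \<longrightarrow> separated 3 (\<lambda>j. ?w (xs ! j) p) (\<lambda>j. ?w (xs ! j) q)"
      unfolding all_less_3 separated_def ex_less_3 using c3 c f12
      by (auto simp: xs_def block_word_def Let_def)
    ultimately show "separated 3 (\<lambda>j. ?w (xs ! j) p) (\<lambda>j. ?w (xs ! j) q)" by blast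
  qed
  then show ?thesis by blast
qed

section \<open>Rainbow-triangle saturation for symmetric relations\<close>

definition edge_set :: "('a \<Rightarrow> 'a \<Rightarrow> bool) \<Rightarrow> 'a set set" where
  "edge_set adj = {{x, y} | x y. adj x y}"

text \<open>Saturation for rainbow triangles, with the edges and their colours given as
  a symmetric relation and a function symmetric on that relation.\<close>

definition triangle_saturated ::
    "nat \<Rightarrow> 'a set \<Rightarrow> ('a \<Rightarrow> 'a \<Rightarrow> bool) \<Rightarrow> ('a \<Rightarrow> 'a \<Rightarrow> nat) \<Rightarrow> bool" where
  "triangle_saturated t V adj col \<longleftrightarrow>
     (\<forall>x y. adj x y \<longrightarrow> x \<in> V \<and> y \<in> V \<and> x \<noteq> y \<and> adj y x \<and> col x y = col y x \<and> col x y \<in> {1..t}) \<and>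
     (\<forall>x y z. adj x y \<longrightarrow> adj y z \<longrightarrow> adj x z \<longrightarrow>
        col x y = col y z \<or> col x y = col x z \<or> col y z = col x z) \<and>
     (\<forall>x\<in>V. \<forall>y\<in>V. x \<noteq> y \<longrightarrow> \<not> adj x y \<longrightarrow>
        (\<forall>i. \<exists>w. adj x w \<and> adj y w \<and> col x w \<noteq> col y w \<and> col x w \<noteq> i \<and> col y w \<noteq> i))"

lemma triangle_saturated_edge:
  "triangle_saturated t V adj col \<Longrightarrow> adj x y \<Longrightarrow>
     x \<in> V \<and> y \<in> V \<and> x \<noteq> y \<and> adj y x \<and> col x y = col y x \<and> col x y \<in> {1..t}"
  unfolding triangle_saturated_def by blast

lemma triangle_saturated_triangle:
  "triangle_saturated t V adj col \<Longrightarrow> adj x y \<Longrightarrow> adj y z \<Longrightarrow> adj x z \<Longrightarrow>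
     col x y = col y z \<or> col x y = col x z \<or> col y z = col x z"
  unfolding triangle_saturated_def by blast

lemma triangle_saturated_nonedge:
  assumes "triangle_saturated t V adj col" "x \<in> V" "y \<in> V" "x \<noteq> y" "\<not> adj x y"
  obtains w where "adj x w" "adj y w" "col x w \<noteq> col y w" "col x w \<noteq> i" "col y w \<noteq> i"
  using assms unfolding triangle_saturated_def by blast

lemma triangle_saturatedI:
  assumes "\<And>x y. adj x y \<Longrightarrow>
      x \<in> V \<and> y \<in> V \<and> x \<noteq> y \<and> adj y x \<and> col x y = col y x \<and> col x y \<in> {1..t}"
    and "\<And>x y z. adj x y \<Longrightarrow> adj y z \<Longrightarrow> adj x z \<Longrightarrow>
      col x y = col y z \<or> col x y = col x z \<or> col y z = col x z"
    and "\<And>x y i. x \<in> V \<Longrightarrow> y \<in> V \<Longrightarrow> x \<noteq> y \<Longrightarrow> \<not> adj x y \<Longrightarrow>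
      \<exists>w. adj x w \<and> adj y w \<and> col x w \<noteq> col y w \<and> col x w \<noteq> i \<and> col y w \<noteq> i"
  shows "triangle_saturated t V adj col"
  using assms unfolding triangle_saturated_def by blast

lemma all_pairs_3: "all_pairs {..<3::nat} = {{0, 1}, {1, 2}, {0, 2}}"
proof -
  have "e \<in> {{0, 1}, {1, 2}, {0, 2}}" if e: "e \<in> all_pairs {..<3::nat}" for e
  proof -
    obtain a b where "e = {a, b}" "a \<noteq> b"
      using e unfolding all_pairs_def card_2_iff by blast
    moreover from this have "a < 3" "b < 3" using e by (auto simp: all_pairs_def)
    ultimately show ?thesis
      by (auto simp: numeral_3_eq_3 less_Suc_eq numeral_2_eq_2 insert_commute)
  qed
  then show ?thesis by (auto simp: all_pairs_def)
qed

lemma rainbow_triangle_iff: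
  "(K, c) \<in> rainbow_copies (complete_graph 3) \<longleftrightarrow>
     (\<exists>x y z. x \<noteq> y \<and> y \<noteq> z \<and> x \<noteq> z \<and> K = ({x, y, z}, {{x, y}, {y, z}, {x, z}}) \<and>
        c {x, y} \<noteq> c {y, z} \<and> c {x, y} \<noteq> c {x, z} \<and> c {y, z} \<noteq> c {x, z})"
    (is "?L \<longleftrightarrow> ?R")
proof
  assume ?L
  then obtain f where f: "bij_betw f {..<3::nat} (verts K)" "edges K = (\<lambda>e. f ` e) ` {{0, 1}, {1, 2}, {0, 2}}"
    and c: "inj_on c (edges K)"
    by (auto simp: rainbow_copies_def graph_iso_def complete_graph_def all_pairs_3)
  have E: "edges K = {{f 0, f 1}, {f 1, f 2}, {f 0, f 2}}" using f(2) by auto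
  have "{..<3::nat} = {0, 1, 2}" by auto
  with f(1) have V: "verts K = {f 0, f 1, f 2}" and d: "f 0 \<noteq> f 1" "f 1 \<noteq> f 2" "f 0 \<noteq> f 2"
    by (auto simp: bij_betw_def inj_on_def)
  have "{f 0, f 1} \<noteq> {f 1, f 2}" "{f 0, f 1} \<noteq> {f 0, f 2}" "{f 1, f 2} \<noteq> {f 0, f 2}"
    using d by (auto simp: doubleton_eq_iff)
  then have "c {f 0, f 1} \<noteq> c {f 1, f 2}" "c {f 0, f 1} \<noteq> c {f 0, f 2}" "c {f 1, f 2} \<noteq> c {f 0, f 2}"
    using c unfolding E by (auto dest!: inj_onD)
  moreover have "K = ({f 0, f 1, f 2}, {{f 0, f 1}, {f 1, f 2}, {f 0, f 2}})"
    using E V by (metis prod.collapse)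
  ultimately show ?R using d by blast
next
  assume ?R
  then obtain x y z where d: "x \<noteq> y" "y \<noteq> z" "x \<noteq> z" and K: "K = ({x, y, z}, {{x, y}, {y, z}, {x, z}})"
    and c: "c {x, y} \<noteq> c {y, z}" "c {x, y} \<noteq> c {x, z}" "c {y, z} \<noteq> c {x, z}" by blast
  define f where "f n = (if n = 0 then x else if n = 1 then y else z)" for n :: nat
  have "{..<3::nat} = {0, 1, 2}" by auto
  then have "bij_betw f {..<3::nat} (verts K)"
    using d by (auto simp: bij_betw_def inj_on_def K f_def)
  moreover have "edges K = (\<lambda>e. f ` e) ` {{0, 1}, {1, 2}, {0, 2}}" by (simp add: K f_def insert_commute)
  ultimately have "graph_iso (complete_graph 3) K"
    unfolding graph_iso_def complete_graph_def fst_conv snd_conv all_pairs_3 by blast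
  moreover have "fin_graph K" using d by (auto simp: fin_graph_def all_pairs_def K)
  moreover have "inj_on c (edges K)" using c by (auto simp: inj_on_def K)
  ultimately show ?L by (simp add: rainbow_copies_def)
qed

text \<open>Distinctness of \<open>x\<close>, \<open>y\<close>, \<open>z\<close> need not be stated:
  the members of \<open>E\<close> have two elements.\<close>

lemma contains_rainbow_triangle_iff:
  assumes "finite V" "E \<subseteq> all_pairs V"
  shows "contains_member (rainbow_copies (complete_graph 3)) ((V, E), c) \<longleftrightarrow>
     (\<exists>x y z. {{x, y}, {y, z}, {x, z}} \<subseteq> E \<and>
        c {x, y} \<noteq> c {y, z} \<and> c {x, y} \<noteq> c {x, z} \<and> c {y, z} \<noteq> c {x, z})"
    (is "?L \<longleftrightarrow> ?R")
proof
  assume ?L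
  then obtain K where K: "subgraph K (V, E)" "(K, c) \<in> rainbow_copies (complete_graph 3)"
    by (auto simp: contains_member_def)
  obtain x y z where "edges K = {{x, y}, {y, z}, {x, z}}"
      "c {x, y} \<noteq> c {y, z} \<and> c {x, y} \<noteq> c {x, z} \<and> c {y, z} \<noteq> c {x, z}"
    using K(2) unfolding rainbow_triangle_iff by auto
  moreover have "edges K \<subseteq> E" using K(1) by (simp add: subgraph_def)
  ultimately show ?R by metis
next
  assume ?R
  then obtain x y z where E: "{{x, y}, {y, z}, {x, z}} \<subseteq> E"
    and c: "c {x, y} \<noteq> c {y, z}" "c {x, y} \<noteq> c {x, z}" "c {y, z} \<noteq> c {x, z}"
    by (elim exE conjE)
  have "{{x, y}, {y, z}, {x, z}} \<subseteq> all_pairs V" using E assms(2) by (rule order_trans)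
  then have d: "x \<noteq> y" "y \<noteq> z" "x \<noteq> z" "{x, y, z} \<subseteq> V"
    by (auto simp: all_pairs_def)
  let ?K = "({x, y, z}, {{x, y}, {y, z}, {x, z}})"
  have "(?K, c) \<in> rainbow_copies (complete_graph 3)"
    unfolding rainbow_triangle_iff
    by (rule exI[of _ x], rule exI[of _ y], rule exI[of _ z]) (use c d in simp)
  moreover have "subgraph ?K (V, E)"
    using E d by (auto simp: subgraph_def fin_graph_def all_pairs_def)
  ultimately show ?L unfolding contains_member_def by blast
qed

text \<open>Colourings in \<open>saturated\<close> are functions of sets, while \<open>col\<close>
  takes ordered pairs. Listing an edge by \<open>Min\<close> and \<open>Max\<close> translates
  between them, and symmetry of \<open>col\<close> on edges makes the order harmless. Adding an edge
  overrides the colouring there only, so the edges to the witness \<open>w\<close> keep their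
  colours.\<close>

lemma triangle_saturated_imp_saturated:
  fixes V :: "'a :: linorder set"
  assumes "finite V" and ts: "triangle_saturated t V adj col"
  shows "saturated t (rainbow_copies (complete_graph 3))
           ((V, edge_set adj), \<lambda>e. col (Min e) (Max e))"
proof -
  let ?E = "edge_set adj" and ?c = "\<lambda>e. col (Min e) (Max e)"
  have sym: "adj x y \<Longrightarrow> x \<in> V \<and> y \<in> V \<and> x \<noteq> y \<and> adj y x \<and> col x y = col y x \<and> col x y \<in> {1..t}" for x y
    using triangle_saturated_edge[OF ts] by blast
  have E_iff: "{x, y} \<in> ?E \<longleftrightarrow> adj x y" for x y
    using sym by (auto simp: edge_set_def doubleton_eq_iff)
  have c: "?c {x, y} = col x y" if "adj x y" for x y
    using sym[OF that] by (auto simp: min_def max_def)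
  have "{x, y} \<in> all_pairs V" if "adj x y" for x y
    using sym[OF that] by (simp add: all_pairs_def)
  then have E: "?E \<subseteq> all_pairs V" by (auto simp: edge_set_def)
  have "?c e \<in> {1..t}" if "e \<in> ?E" for e
  proof -
    obtain x y where e: "e = {x, y}" and xy: "adj x y" using \<open>e \<in> ?E\<close> unfolding edge_set_def by blast
    show ?thesis unfolding e c[OF xy] using sym[OF xy] by blast
  qed
  then have "edge_coloured t ((V, ?E), ?c)"
    using assms(1) E unfolding edge_coloured_def fin_graph_def by simp
  moreover have "\<not> contains_member (rainbow_copies (complete_graph 3)) ((V, ?E), ?c)"
  proof
    assume "contains_member (rainbow_copies (complete_graph 3)) ((V, ?E), ?c)"
    then obtain x y z where xyz: "adj x y" "adj y z" "adj x z"
        and "?c {x, y} \<noteq> ?c {y, z}" "?c {x, y} \<noteq> ?c {x, z}" "?c {y, z} \<noteq> ?c {x, z}"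
      unfolding contains_rainbow_triangle_iff[OF assms(1) E] insert_subset E_iff by blast
    then have "col x y \<noteq> col y z" "col x y \<noteq> col x z" "col y z \<noteq> col x z"
      unfolding c[OF xyz(1)] c[OF xyz(2)] c[OF xyz(3)] by blast+
    then show False using triangle_saturated_triangle[OF ts xyz] by blast
  qed
  moreover have "contains_member (rainbow_copies (complete_graph 3)) (add_edge e i ((V, ?E), ?c))"
    if e: "e \<in> all_pairs V - ?E" for e i
  proof -
    obtain x y where xy: "e = {x, y}" "x \<noteq> y" "x \<in> V" "y \<in> V"
      using e unfolding all_pairs_def card_2_iff by blast
    have na: "\<not> adj x y" using e E_iff xy by auto
    obtain w where w: "adj x w" "adj y w" "col x w \<noteq> col y w" "col x w \<noteq> i" "col y w \<noteq> i"
      using triangle_saturated_nonedge[OF ts xy(3,4,2) na] .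
    have ne: "x \<noteq> w" "y \<noteq> w" using w sym by blast+
    have E': "insert e ?E \<subseteq> all_pairs V" using E e by blast
    let ?c' = "?c(e := i)"
    have "{w, y} \<noteq> e" "{x, w} \<noteq> e" using xy ne by (auto simp: doubleton_eq_iff)
    moreover have "?c {x, w} = col x w" using c[OF w(1)] .
    moreover have "adj w y" "col w y = col y w" using sym[OF w(2)] by simp_all
    then have "?c {w, y} = col y w" using c[of w y] by metis
    ultimately have c': "?c' {x, w} = col x w" "?c' {w, y} = col y w" "?c' {x, y} = i"
      by (simp_all only: fun_upd_apply xy(1) if_True if_False simp_thms)
    have "{{x, w}, {w, y}, {x, y}} \<subseteq> insert e ?E"
      using E_iff w(1) \<open>adj w y\<close> xy(1) by blast
    moreover have "?c' {x, w} \<noteq> ?c' {w, y} \<and> ?c' {x, w} \<noteq> ?c' {x, y} \<and> ?c' {w, y} \<noteq> ?c' {x, y}"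
      unfolding c' using w by blast
    ultimately have "\<exists>x y z. {{x, y}, {y, z}, {x, z}} \<subseteq> insert e ?E \<and>
        ?c' {x, y} \<noteq> ?c' {y, z} \<and> ?c' {x, y} \<noteq> ?c' {x, z} \<and> ?c' {y, z} \<noteq> ?c' {x, z}"
      by blast
    then show ?thesis
      unfolding add_edge_def fst_conv snd_conv prod.case
      by (subst contains_rainbow_triangle_iff[OF assms(1) E'])
  qed
  ultimately show ?thesis unfolding saturated_def by auto
qed

section \<open>Joining three hubs to saturated classes\<close>

definition hub_adj :: "(nat \<Rightarrow> 'a) \<Rightarrow> 'a set \<Rightarrow> ('a \<Rightarrow> 'k) \<Rightarrow> ('k \<Rightarrow> 'a \<Rightarrow> 'a \<Rightarrow> bool) \<Rightarrow> 'a \<Rightarrow> 'a \<Rightarrow> bool" where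
  "hub_adj W U cl A x y \<longleftrightarrow>
     x \<in> W ` {..<3} \<and> y \<in> U \<or> x \<in> U \<and> y \<in> W ` {..<3} \<or> x \<in> U \<and> y \<in> U \<and> cl x = cl y \<and> A (cl x) x y"

text \<open>The hub index is recovered by \<open>inv_into\<close>. When \<open>U\<close> is disjoint
  from the hubs, an edge has at most one hub end, so the order of the tests does not affect
  edges.\<close>

definition hub_col ::
    "(nat \<Rightarrow> 'a) \<Rightarrow> ('a \<Rightarrow> 'k) \<Rightarrow> ('k \<Rightarrow> nat \<Rightarrow> nat) \<Rightarrow> ('k \<Rightarrow> 'a \<Rightarrow> 'a \<Rightarrow> nat) \<Rightarrow> 'a \<Rightarrow> 'a \<Rightarrow> nat" where
  "hub_col W cl v C x y =
     (if x \<in> W ` {..<3} then v (cl y) (inv_into {..<3} W x)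
      else if y \<in> W ` {..<3} then v (cl x) (inv_into {..<3} W y)
      else C (cl x) x y)"

text \<open>In a triangle through a hub the other two vertices are adjacent in \<open>U\<close>,
  hence in one class, and see the hub in the same colour. Non-edges between hubs are saturated by
  \<open>cols\<close>, those between classes by \<open>rows\<close>, those inside a class by
  \<open>parts\<close>. Since a word matters only if its class is inhabited, \<open>cols\<close>
  asks for an actual vertex of \<open>U\<close>.\<close>

lemma hub_triangle_saturated:
  assumes W: "inj_on W {..<3}" and WU: "W ` {..<3} \<inter> U = {}"
    and parts: "\<And>u. u \<in> U \<Longrightarrow> triangle_saturated t {u'\<in>U. cl u' = cl u} (A (cl u)) (C (cl u))"
    and v: "\<And>u p. u \<in> U \<Longrightarrow> p < 3 \<Longrightarrow> v (cl u) p \<in> {1..t}"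
    and rows: "\<And>u u'. u \<in> U \<Longrightarrow> u' \<in> U \<Longrightarrow> cl u \<noteq> cl u' \<Longrightarrow> separated 3 (v (cl u)) (v (cl u'))"
    and cols: "\<And>p q i. p < 3 \<Longrightarrow> q < 3 \<Longrightarrow> p \<noteq> q \<Longrightarrow>
        \<exists>u\<in>U. v (cl u) p \<noteq> v (cl u) q \<and> v (cl u) p \<noteq> i \<and> v (cl u) q \<noteq> i"
  shows "triangle_saturated t (W ` {..<3} \<union> U) (hub_adj W U cl A) (hub_col W cl v C)"
proof -
  let ?W = "W ` {..<3}" and ?a = "hub_adj W U cl A" and ?c = "hub_col W cl v C"
  have idx: "inv_into {..<3} W (W p) = p" if "p < 3" for p using W that by auto
  have nW: "u \<notin> ?W" if "u \<in> U" for u using WU that by blast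
  have cW: "?c (W p) u = v (cl u) p" "?c u (W p) = v (cl u) p" if "p < 3" "u \<in> U" for p u
    using that idx nW unfolding hub_col_def by auto
  have cU: "?c x y = C (cl x) x y" if "x \<in> U" "y \<in> U" for x y
    using that nW unfolding hub_col_def by auto
  have aW: "?a (W p) u" "?a u (W p)" if "p < 3" "u \<in> U" for p u
    using that unfolding hub_adj_def by auto
  have part: "x \<noteq> y \<and> A (cl x) y x \<and> C (cl x) x y = C (cl x) y x \<and> C (cl x) x y \<in> {1..t}"
    if "x \<in> U" "A (cl x) x y" for x y
    using triangle_saturated_edge[OF parts[OF that(1)] that(2)] by blast
  have edge: "x \<in> ?W \<union> U \<and> y \<in> ?W \<union> U \<and> x \<noteq> y \<and> ?a y x \<and> ?c x y = ?c y x \<and> ?c x y \<in> {1..t}"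
    if a: "?a x y" for x y
  proof -
    consider p where "p < 3" "x = W p" "y \<in> U" | p where "p < 3" "y = W p" "x \<in> U"
      | "x \<in> U" "y \<in> U" "cl x = cl y" "A (cl x) x y"
      using a unfolding hub_adj_def by auto
    then show ?thesis
    proof cases
      case 1
      then show ?thesis using cW[OF 1(1,3)] aW[OF 1(1,3)] v[OF 1(3,1)] nW by auto
    next
      case 2
      then show ?thesis using cW[OF 2(1,3)] aW[OF 2(1,3)] v[OF 2(3,1)] nW by auto
    next
      case 3
      then show ?thesis using part[OF 3(1,4)] cU by (auto simp: hub_adj_def)
    qed
  qed
  have tri: "?c x y = ?c y z \<or> ?c x y = ?c x z \<or> ?c y z = ?c x z"
    if a: "?a x y" "?a y z" "?a x z" for x y z
  proof -
    have *: "?c w x = ?c w y" if "?a x y" "w \<in> ?W" "?a w x" "?a w y" for w x y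
    proof -
      have "x \<in> U" "y \<in> U" using that nW by (auto simp: hub_adj_def)
      then have "cl x = cl y" using that(1) nW by (auto simp: hub_adj_def)
      then show ?thesis using that(2) by (simp add: hub_col_def)
    qed
    consider "x \<in> ?W" | "y \<in> ?W" | "z \<in> ?W" | "x \<notin> ?W" "y \<notin> ?W" "z \<notin> ?W" by blast
    then show ?thesis
    proof cases
      case 1 then show ?thesis using * a by blast
    next
      case 2 then show ?thesis using *[of x z y] a edge by metis
    next
      case 3 then show ?thesis using *[of x y z] a edge by metis
    next
      case 4
      then have U: "x \<in> U" "y \<in> U" "z \<in> U" "cl y = cl x" "cl z = cl x"
        "A (cl x) x y" "A (cl x) y z" "A (cl x) x z"
        using a by (auto simp: hub_adj_def)
      then show ?thesis using triangle_saturated_triangle[OF parts[OF U(1)] U(6-8)] cU by simp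
    qed
  qed
  have sat: "\<exists>w. ?a x w \<and> ?a y w \<and> ?c x w \<noteq> ?c y w \<and> ?c x w \<noteq> i \<and> ?c y w \<noteq> i"
    if xy: "x \<in> ?W \<union> U" "y \<in> ?W \<union> U" "x \<noteq> y" "\<not> ?a x y" for x y i
  proof -
    consider p q where "p < 3" "q < 3" "x = W p" "y = W q" "p \<noteq> q"
      | "x \<in> U" "y \<in> U" "cl x \<noteq> cl y" | "x \<in> U" "y \<in> U" "cl x = cl y" "\<not> A (cl x) x y"
      using xy unfolding hub_adj_def by blast
    then show ?thesis
    proof cases
      case 1
      then obtain u where "u \<in> U" "v (cl u) p \<noteq> v (cl u) q \<and> v (cl u) p \<noteq> i \<and> v (cl u) q \<noteq> i"
        using cols by blast
      then show ?thesis using 1 aW cW by metis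
    next
      case 2
      then obtain p where "p < 3" "v (cl x) p \<noteq> v (cl y) p \<and> v (cl x) p \<noteq> i \<and> v (cl y) p \<noteq> i"
        using rows unfolding separated_def by blast
      then show ?thesis using 2 aW cW by metis
    next
      case 3
      then have "x \<in> {u \<in> U. cl u = cl x}" "y \<in> {u \<in> U. cl u = cl x}" by auto
      from triangle_saturated_nonedge[OF parts[OF 3(1)] this xy(3) 3(4)]
      obtain w where w: "A (cl x) x w" "A (cl x) y w" "C (cl x) x w \<noteq> C (cl x) y w"
          "C (cl x) x w \<noteq> i" "C (cl x) y w \<noteq> i" .
      moreover have "w \<in> U" "cl w = cl x"
        using triangle_saturated_edge[OF parts[OF 3(1)] w(1)] by auto
      ultimately show ?thesis using 3 cU by (intro exI[of _ w]) (auto simp: hub_adj_def)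
    qed
  qed
  show ?thesis using edge tri sat by (rule triangle_saturatedI)
qed

lemma card_hub_edges:
  assumes "finite U" "\<And>k. k \<in> K \<Longrightarrow> finite (edge_set (A k))" "finite K" "cl ` U \<subseteq> K"
  shows "card (edge_set (hub_adj W U cl A)) \<le> 3 * card U + (\<Sum>k\<in>K. card (edge_set (A k)))"
proof -
  let ?H = "(\<lambda>(w, u). {w, u}) ` (W ` {..<3} \<times> U)" and ?R = "\<Union>k\<in>K. edge_set (A k)"
  have "{x, y} \<in> ?H \<union> ?R" if "hub_adj W U cl A x y" for x y
    using that assms(4) unfolding hub_adj_def
  proof (elim disjE conjE)
    assume "x \<in> U" "y \<in> W ` {..<3}"
    then have "{x, y} \<in> ?H" by (intro image_eqI[of _ _ "(y, x)"]) auto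
    then show ?thesis by blast
  qed (auto simp: edge_set_def)
  then have sub: "edge_set (hub_adj W U cl A) \<subseteq> ?H \<union> ?R"
    unfolding edge_set_def[of "hub_adj W U cl A"] by blast
  have "card ?H \<le> card (W ` {..<3} \<times> U)" using assms(1) by (intro card_image_le) auto
  also have "\<dots> \<le> 3 * card U"
    using card_image_le[of "{..<3::nat}" W] by (simp add: card_cartesian_product)
  finally have "card ?H \<le> 3 * card U" .
  moreover have "card ?R \<le> (\<Sum>k\<in>K. card (edge_set (A k)))" using assms(3) by (rule card_UN_le)
  moreover have "card (edge_set (hub_adj W U cl A)) \<le> card (?H \<union> ?R)"
    using sub assms by (intro card_mono) auto
  ultimately show ?thesis using card_Un_le[of ?H ?R] by linarith
qed

lemma edge_set_finite:
  assumes "finite V" "triangle_saturated t V adj col"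
  shows "finite (edge_set adj)"
proof (rule finite_subset[of _ "Pow V"])
  show "edge_set adj \<subseteq> Pow V" using assms(2) by (auto simp: edge_set_def triangle_saturated_def)
qed (use assms(1) in simp)

section \<open>Recursion over balanced classes\<close>

text \<open>Inside a residue class \<open>j\<close> is determined by \<open>j div N\<close>, which
  is below \<open>q\<close>.\<close>

lemma card_residue_class:
  assumes "m \<le> q * (N::nat)"
  shows "card {j. j < m \<and> j mod N = k} \<le> q"
proof -
  have "j div N < q" if "j < m" for j
    using that assms by (metis less_le_trans less_mult_imp_div_less)
  moreover have "inj_on (\<lambda>j. j div N) {j. j < m \<and> j mod N = k}"
    by (rule inj_onI) (metis (mono_tags, lifting) mem_Collect_eq div_mult_mod_eq)
  ultimately have "card {j. j < m \<and> j mod N = k} \<le> card {..<q}"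
    by (intro card_inj_on_le[of "\<lambda>j. j div N"]) auto
  then show ?thesis by simp
qed

text \<open>A one-coloured complete graph has no non-edge to saturate; it ends the recursion on
  small vertex sets.\<close>

lemma monochromatic_triangle_saturated:
  "t \<ge> 1 \<Longrightarrow> triangle_saturated t V (\<lambda>x y. x \<in> V \<and> y \<in> V \<and> x \<noteq> y) (\<lambda>_ _. 1)"
  unfolding triangle_saturated_def by auto

lemma card_complete_edges:
  assumes "finite V"
  shows "card (edge_set (\<lambda>x y. x \<in> V \<and> y \<in> V \<and> x \<noteq> y)) = card V choose 2"
proof -
  have "edge_set (\<lambda>x y. x \<in> V \<and> y \<in> V \<and> x \<noteq> y) = {e. e \<subseteq> V \<and> card e = 2}"
    by (auto simp: edge_set_def card_2_iff)
  then show ?thesis using n_subsets[OF assms] by simp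
qed

text \<open>Induction on the number of levels: the hubs cost three edges per remaining vertex, and
  the classes, each of size at most \<open>N ^ d\<close>, together cost at most \<open>3 * d\<close>
  per vertex.\<close>

lemma ex_triangle_saturated:
  fixes V :: "'a set" and v :: "nat \<Rightarrow> nat \<Rightarrow> nat"
  assumes t: "t \<ge> 1" and N: "N \<ge> 3"
    and code: "rainbow_code t N v"
    and "finite V" "card V \<le> N ^ d"
  shows "\<exists>adj col. triangle_saturated t V adj col \<and> card (edge_set adj) \<le> 3 * card V * d"
  using assms(4,5)
proof (induction d arbitrary: V)
  case 0
  have "card V choose 2 = 0" using 0 by (simp add: binomial_eq_0)
  then show ?case
    using monochromatic_triangle_saturated[OF t] card_complete_edges[OF 0(1)] by fastforce
next
  case (Suc d)
  have v: "v j p \<in> {1..t}" if "j < N" "p < 3" for j p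
    using code that unfolding rainbow_code_def by blast
  have rows: "separated 3 (v j) (v k)" if "j < N" "k < N" "j \<noteq> k" for j k
    using code that unfolding rainbow_code_def by blast
  have cols: "separated 3 (\<lambda>j. v j p) (\<lambda>j. v j q)" if "p < 3" "q < 3" "p \<noteq> q" for p q
    using code that unfolding rainbow_code_def by blast
  show ?case
  \<comment> \<open>Six vertices are the least that provide three hubs and one vertex in each of the
    classes 0, 1, 2. Below that, the complete graph is cheap enough.\<close>
  proof (cases "card V < 6")
    case True
    then have "card V * (card V - 1) \<le> card V * 6" by (intro mult_le_mono) auto
    then have "card V choose 2 \<le> card V * 6 div 2" unfolding choose_two by (rule div_le_mono)
    then have "card V choose 2 \<le> 3 * card V" by simp
    also have "\<dots> \<le> 3 * card V * Suc d" by simp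
    finally show ?thesis
      using monochromatic_triangle_saturated[OF t, of V] card_complete_edges[OF Suc(2)]
      by (intro exI[of _ "\<lambda>x y. x \<in> V \<and> y \<in> V \<and> x \<noteq> y"] exI[of _ "\<lambda>_ _. 1"] conjI) simp_all
  next
    case False
    then obtain Ws where Ws: "Ws \<subseteq> V" "card Ws = 3" using obtain_subset_with_card_n[of 3 V] by auto
    then have fW: "finite Ws" using Suc(2) finite_subset by blast
    obtain W where W: "bij_betw W {..<3::nat} Ws"
      using ex_bij_betw_nat_finite[OF fW] Ws(2) by (auto simp: atLeast0LessThan)
    define U where "U = V - Ws"
    have V: "V = W ` {..<3} \<union> U" and WU: "W ` {..<3} \<inter> U = {}" and injW: "inj_on W {..<3}"
      using W Ws by (auto simp: U_def bij_betw_def)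
    have fU: "finite U" using Suc(2) by (simp add: U_def)
    have cU: "card V = card U + 3" unfolding U_def
      using card_Diff_subset[OF fW Ws(1)] Ws(2) False by simp
    obtain e where e: "bij_betw e U {..<card U}"
      using ex_bij_betw_finite_nat[OF fU] by (auto simp: atLeast0LessThan)
    \<comment> \<open>Residues of a numbering keep the classes balanced and put the vertices
      numbered 0, 1, 2 into classes 0, 1, 2, as the separation of the hubs requires.\<close>
    define cl where "cl u = e u mod N" for u
    define part where "part k = {u\<in>U. cl u = k}" for k
    have fp: "finite (part k)" for k using fU by (simp add: part_def)
    have "card (part k) \<le> N ^ d" for k
    proof -
      have "card (part k) = card (e ` part k)"
        using e by (intro card_image[symmetric]) (auto simp: bij_betw_def part_def inj_on_def)
      also have "\<dots> \<le> card {j. j < card U \<and> j mod N = k}"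
        using e by (intro card_mono) (auto simp: part_def cl_def bij_betw_def)
      also have "\<dots> \<le> N ^ d"
        using Suc(3) cU by (intro card_residue_class) (simp add: mult.commute)
      finally show ?thesis .
    qed
    then have "\<forall>k. \<exists>adj col. triangle_saturated t (part k) adj col \<and>
        card (edge_set adj) \<le> 3 * card (part k) * d"
      using Suc.IH fp by blast
    then obtain A C where AC: "\<And>k. triangle_saturated t (part k) (A k) (C k)"
        "\<And>k. card (edge_set (A k)) \<le> 3 * card (part k) * d"
      by metis
    have clN: "cl u < N" for u using N by (simp add: cl_def)
    have "triangle_saturated t (W ` {..<3} \<union> U) (hub_adj W U cl A) (hub_col W cl v C)"
    proof (rule hub_triangle_saturated[OF injW WU])
      fix u show "triangle_saturated t {u' \<in> U. cl u' = cl u} (A (cl u)) (C (cl u))"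
        using AC(1) by (simp add: part_def)
    next
      fix p q i :: nat assume "p < 3" "q < 3" "p \<noteq> q"
      then obtain j where j: "j < 3" "v j p \<noteq> v j q" "v j p \<noteq> i" "v j q \<noteq> i"
        using cols unfolding separated_def by blast
      then have "j < card U" using False cU by simp
      then have "j \<in> e ` U" using e by (simp add: bij_betw_def)
      then obtain u where "u \<in> U" "e u = j" by blast
      moreover from this have "cl u = j" using j N by (simp add: cl_def)
      ultimately show "\<exists>u\<in>U. v (cl u) p \<noteq> v (cl u) q \<and> v (cl u) p \<noteq> i \<and> v (cl u) q \<noteq> i"
        using j by (intro bexI[of _ u]) simp_all
    qed (use clN v rows in auto)
    moreover have "card (edge_set (hub_adj W U cl A)) \<le> 3 * card V * Suc d"
    proof -
      have "card (edge_set (hub_adj W U cl A)) \<le> 3 * card U + (\<Sum>k<N. card (edge_set (A k)))"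
        using edge_set_finite[OF fp AC(1)] clN fU by (intro card_hub_edges) auto
      moreover have "(\<Sum>k<N. card (edge_set (A k))) \<le> (\<Sum>k<N. 3 * card (part k) * d)"
        by (intro sum_mono AC)
      moreover have "(\<Sum>k<N. 3 * card (part k) * d) = 3 * d * (\<Sum>k<N. card (part k))"
        by (simp add: sum_distrib_left mult_ac)
      moreover have "(\<Sum>k<N. card (part k)) = card (\<Union>k<N. part k)"
        using fp by (intro card_UN_disjoint[symmetric]) (auto simp: part_def)
      moreover have "(\<Union>k<N. part k) = U" using clN by (auto simp: part_def)
      ultimately have "card (edge_set (hub_adj W U cl A)) \<le> 3 * card U + 3 * d * card U"
        by simp
      then show ?thesis using cU by (simp add: algebra_simps)
    qed
    ultimately show ?thesis unfolding V[symmetric] by blast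
  qed
qed

lemma sat_le:
  assumes t: "t \<ge> 1" and N: "N \<ge> 3"
    and code: "rainbow_code t N v"
    and n: "n \<le> N ^ d"
  shows "sat t n (rainbow_copies (complete_graph 3)) \<le> 3 * n * d"
proof -
  obtain adj col where ts: "triangle_saturated t {..<n} adj col"
      and le: "card (edge_set adj) \<le> 3 * card {..<n} * d"
    using ex_triangle_saturated[OF t N code, of "{..<n}" d] n by auto
  let ?G = "({..<n}, edge_set adj)"
  have "saturated t (rainbow_copies (complete_graph 3)) (?G, \<lambda>e. col (Min e) (Max e))"
    using triangle_saturated_imp_saturated[OF _ ts] by simp
  then have "\<exists>c. card (edge_set adj) = card (edges ?G) \<and> card (verts ?G) = n \<and>
      saturated t (rainbow_copies (complete_graph 3)) (?G, c)"
    by auto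
  then have "sat t n (rainbow_copies (complete_graph 3)) \<le> card (edge_set adj)"
    unfolding sat_def by (intro cInf_lower CollectI exI[of _ ?G]) simp_all
  with le show ?thesis by simp
qed

section \<open>The logarithmic bound\<close>

text \<open>The exponent is the logarithm of \<open>n\<close> to base \<open>N\<close> rounded up.
  Rounding costs at most 1, which becomes the summand \<open>3 * n\<close> of the final
  bound.\<close>

lemma ex_power_exponent:
  assumes "N \<ge> 3" "n \<ge> 1"
  shows "\<exists>d. n \<le> N ^ d \<and> real d \<le> log 2 (real n) / log 2 (real N) + 1"
proof -
  let ?d = "nat \<lceil>log (real N) (real n)\<rceil>"
  have pos: "0 \<le> log (real N) (real n)" using assms by (simp add: zero_le_log_cancel_iff)
  then have d: "log (real N) (real n) \<le> real ?d" "real ?d \<le> log (real N) (real n) + 1"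
    by linarith+
  have "log (real N) (real n) \<le> real ?d \<longleftrightarrow> real n \<le> real N powr real ?d"
    using assms by (intro log_le_iff) auto
  with d have "real n \<le> real N powr real ?d" by blast
  also have "\<dots> = real (N ^ ?d)"
    by (subst powr_realpow) (use assms in auto)
  finally have "n \<le> N ^ ?d" by (simp only: of_nat_le_iff)
  moreover have "log (real N) (real n) = log 2 (real n) / log 2 (real N)"
    using assms by (intro log_base_change) auto
  ultimately show ?thesis using d(2) by (intro exI[of _ ?d]) (simp only: simp_thms)
qed

lemma sat_rainbow_triangle_le:
  assumes t: "t \<ge> 3" "[t = 1] (mod 6) \<or> [t = 3] (mod 6)"
  shows "real (sat t n (rainbow_copies (complete_graph 3)))
     \<le> 3 / log 2 (real (t choose 2)) * real n * log 2 (real n) + 3 * real n"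
proof -
  obtain f :: "nat \<Rightarrow> nat \<Rightarrow> nat" where f: "steiner_quasigroup {1..t} f"
    using ex_steiner_quasigroup[OF t] by blast
  obtain v where v: "rainbow_code t (t choose 2) v"
    using ex_code[OF f t(1)] by blast
  let ?N = "t choose 2"
  have "3 * 2 \<le> t * (t - 1)" using t(1) by (intro mult_le_mono) auto
  then have "3 * 2 div 2 \<le> ?N" unfolding choose_two by (rule div_le_mono)
  then have N: "?N \<ge> 3" by simp
  have t1: "t \<ge> 1" using t(1) by simp
  have bound: "sat t n (rainbow_copies (complete_graph 3)) \<le> 3 * n * d" if "n \<le> ?N ^ d" for d
    using sat_le[OF t1 N v that] .
  show ?thesis
  proof (cases "n = 0")
    \<comment> \<open>The factor \<open>n\<close> makes the right-hand side 0, whatever the value of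
      \<open>log 2 0\<close>, and zero levels give the bound 0 on the left.\<close>
    case True
    then show ?thesis using bound[of 0] by simp
  next
    case False
    then obtain d where d: "n \<le> ?N ^ d" "real d \<le> log 2 (real n) / log 2 (real ?N) + 1"
      using ex_power_exponent[OF N, of n] by auto
    have "real (sat t n (rainbow_copies (complete_graph 3))) \<le> real (3 * n * d)"
      using bound[OF d(1)] by (rule of_nat_mono)
    also have "\<dots> = 3 * real n * real d" by simp
    also have "\<dots> \<le> 3 * real n * (log 2 (real n) / log 2 (real ?N) + 1)"
      using d(2) by (intro mult_left_mono) auto
    finally show ?thesis by (simp add: algebra_simps)
  qed
qed

theorem theorem3p16:
  "(\<forall>t n :: nat. t \<ge> 3 \<and> ([t = 1] (mod 6) \<or> [t = 3] (mod 6)) \<longrightarrow>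
      real (sat t n (rainbow_copies (complete_graph 3)))
        \<le> 3 / log 2 (real (t choose 2)) * real n * log 2 (real n) + 3 * real n) \<and>
   (\<forall>n :: nat.
      real (sat 3 n (rainbow_copies (complete_graph 3)))
        \<le> 3 / log 2 3 * real n * log 2 (real n) + 3 * real n)"
proof (intro conjI allI impI)
  fix t n :: nat
  assume "t \<ge> 3 \<and> ([t = 1] (mod 6) \<or> [t = 3] (mod 6))"
  then show "real (sat t n (rainbow_copies (complete_graph 3)))
      \<le> 3 / log 2 (real (t choose 2)) * real n * log 2 (real n) + 3 * real n"
    by (intro sat_rainbow_triangle_le) auto
next
  fix n :: nat
  have "real (3 choose 2) = 3" by (simp add: choose_two)
  then show "real (sat 3 n (rainbow_copies (complete_graph 3)))
      \<le> 3 / log 2 3 * real n * log 2 (real n) + 3 * real n"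
    using sat_rainbow_triangle_le[of 3 n] by simp
qed

end
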